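(* Let $U\subseteq\mathbb{R}^n$ be open and let $F:U\to\mathbb{R}^n$ be a continuous injective map that preserves all denominators. If $F$ is differentiable at a point $u\in U$ with Jacobian matrix $A$ with respect to the standard basis of $\mathbb{R}^n$, then $A\in\mathrm{GL}_n\mathbb{Z}$. In particular, if $F$ is continuously differentiable on an open connected set $V\subseteq U$, then there exist $A\in\mathrm{GL}_n\mathbb{Z}$ and $w\in\mathbb{Z}^n$ such that $F(v)=Av+w$ for all $v\in V$.
   Context: Every $u\in\mathbb{Q}^n$ can be written uniquely as $u=(a_1/k,\ldots,a_n/k)$ with $a_1,\ldots,a_n,k$ integers, $k\ge1$, and $\gcd(a_1,\ldots,a_n,k)=1$; then $k=\mathrm{den}(u)$ is the denominator of $u$. A map $F:U\to\mathbb{R}^n$ preserves all denominators if for every integer $k\ge1$ it induces a bijection between $\{u\in U\cap\mathbb{Q}^n:\mathrm{den}(u)=k\}$ and $\{v\in F[U]\cap\mathbb{Q}^n:\mathrm{den}(v)=k\}$. *)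

theory Defs
  imports "HOL-Analysis.Analysis"
begin

definition rational_points :: "(real ^ 'n) set" where
  "rational_points = {u. \<forall>i. u $ i \<in> \<rat>}"

definition integer_points :: "(real ^ 'n) set" where
  "integer_points = {u. \<forall>i. u $ i \<in> \<int>}"

definition reduced_form :: "real ^ 'n \<Rightarrow> int ^ 'n \<Rightarrow> int \<Rightarrow> bool" where
  "reduced_form u a k \<longleftrightarrow>
     k \<ge> 1 \<and> (\<forall>i. u $ i = of_int (a $ i) / of_int k) \<and> Gcd (insert k (range (\<lambda>i. a $ i))) = 1"

text \<open>
  The denominator is meaningful only for rational points, where the reduced form exists and is
  unique (see \<open>reduced_form_ex1\<close>); elsewhere its value is unspecified.
\<close>

definition den :: "real ^ 'n \<Rightarrow> int" where
  "den u = (THE k. \<exists>a. reduced_form u a k)"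

definition preserves_all_denominators ::
    "(real ^ 'n) set \<Rightarrow> (real ^ 'n \<Rightarrow> real ^ 'n) \<Rightarrow> bool" where
  "preserves_all_denominators U F \<longleftrightarrow>
     (\<forall>k\<ge>1. bij_betw F {u \<in> U \<inter> rational_points. den u = k}
                       {v \<in> F ` U \<inter> rational_points. den v = k})"

text \<open>
  \<open>GL_int\<close> consists of the invertible matrices over the integers, regarded as real matrices:
  \<^const>\<open>invertible\<close> below is taken in the ring of integer matrices.
\<close>

definition GL_int :: "(real ^ 'n ^ 'n) set" where
  "GL_int = map_matrix of_int ` {A :: int ^ 'n ^ 'n. invertible A}"

text \<open>Intended for open \<open>V\<close>, so the full filter \<^term>\<open>at v\<close> is used.\<close>

definition continuously_differentiable_on ::
    "(real ^ 'n \<Rightarrow> real ^ 'n) \<Rightarrow> (real ^ 'n) set \<Rightarrow> bool" where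
  "continuously_differentiable_on F V \<longleftrightarrow>
     (\<forall>v\<in>V. F differentiable (at v)) \<and> continuous_on V (\<lambda>v. jacobian F (at v))"

lemma reduced_form_unique:
  assumes "reduced_form u a k" "reduced_form u c l"
  shows "a = c \<and> k = l"
proof -
  have k: "k \<ge> 1" "l \<ge> 1" using assms by (auto simp: reduced_form_def)
  have eq: "l * (a $ i) = k * (c $ i)" for i
  proof -
    have "(of_int (a $ i) :: real) / of_int k = of_int (c $ i) / of_int l"
      using assms unfolding reduced_form_def by metis
    then have "of_int (l * (a $ i)) = (of_int (k * (c $ i)) :: real)"
      using k by (simp add: field_simps)
    then show ?thesis by (simp only: of_int_eq_iff)
  qed
  have im: "(*) l ` insert k (range (\<lambda>i. a $ i)) = (*) k ` insert l (range (\<lambda>i. c $ i))"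
    using eq by (simp add: image_image mult.commute)
  have "l = Gcd ((*) l ` insert k (range (\<lambda>i. a $ i)))"
    using assms k unfolding Gcd_mult reduced_form_def by simp
  also have "\<dots> = k"
    unfolding im using assms k unfolding Gcd_mult reduced_form_def by simp
  finally have kl: "k = l" by simp
  then show ?thesis using eq k by (auto simp: vec_eq_iff)
qed

lemma reduced_form_exists:
  fixes u :: "real ^ 'n"
  assumes "u \<in> rational_points"
  shows "\<exists>a k. reduced_form u a k"
proof -
  have "\<exists>m n. n > 0 \<and> u $ i = of_int m / of_int n" for i
    using assms unfolding rational_points_def by (metis (mono_tags, lifting) Rats_cases' mem_Collect_eq)
  then obtain m n where mn: "\<And>i. n i > 0" "\<And>i. u $ i = of_int (m i) / of_int (n i)"
    by metis
  define d where "d = (\<Prod>i\<in>UNIV. n i)"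
  have d: "d > 0" unfolding d_def using mn(1) by (intro prod_pos) auto
  have "n i dvd d" for i unfolding d_def by (rule dvd_prodI) auto
  then have "\<exists>b. u $ i = of_int b / of_int d" for i
  proof -
    obtain q where q: "d = n i * q" using \<open>n i dvd d\<close> by (elim dvdE)
    then have "q \<noteq> 0" using d by auto
    then have "u $ i = of_int (m i * q) / of_int d"
      unfolding mn(2)[of i] q using mn(1)[of i] by simp
    then show ?thesis by blast
  qed
  then obtain b where b: "\<And>i. u $ i = of_int (b i) / of_int d" by metis
  define g where "g = Gcd (insert d (range b))"
  have gd: "g dvd d" and gb: "g dvd b i" for i unfolding g_def by (rule Gcd_dvd; simp)+
  have g: "g > 0" using gd d unfolding g_def
    by (metis Gcd_int_greater_eq_0 dvd_0_left_iff order_le_less less_irrefl)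
  have "reduced_form u (\<chi> i. b i div g) (d div g)"
    unfolding reduced_form_def
  proof (intro conjI allI)
    show "1 \<le> d div g" using gd d g
      by (metis int_one_le_iff_zero_less pos_imp_zdiv_pos_iff zdvd_imp_le)
    show "u $ i = of_int ((\<chi> i. b i div g) $ i) / of_int (d div g)" for i
      using b[of i] gd gb[of i] g d by (auto elim!: dvdE)
    let ?S = "insert (d div g) (range (\<lambda>i. (\<chi> i. b i div g) $ i))"
    have "(*) g ` ?S = insert d (range b)"
      using gd gb by (simp add: image_image)
    then have "normalize (g * Gcd ?S) = g" unfolding Gcd_mult[symmetric] g_def by simp
    then have "g * Gcd ?S = g" using g by (simp add: abs_mult)
    then show "Gcd ?S = 1" using g by simp
  qed
  then show ?thesis by blast
qed

lemma reduced_form_ex1: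
  assumes "u \<in> rational_points"
  shows "\<exists>!p. reduced_form u (fst p) (snd p)"
proof -
  obtain a k where "reduced_form u a k" using reduced_form_exists[OF assms] by blast
  then show ?thesis
    by (intro ex1I[of _ "(a, k)"]) (auto simp: prod_eq_iff dest: reduced_form_unique)
qed

lemma den_eq: "reduced_form u a k \<Longrightarrow> den u = k"
  unfolding den_def by (rule the_equality) (auto dest: reduced_form_unique)

end

theory Submission
  imports Defs
begin

text \<open>
  If \<open>F\<close> preserves all denominators, it maps \<open>U \<inter> (1/k)\<int>\<^sup>n\<close> into \<open>(1/k)\<int>\<^sup>n\<close> for every \<open>k \<ge> 1\<close>.
  Let \<open>z \<in> \<int>\<^sup>n\<close> and let \<open>x\<close> be a point of \<open>(1/k)\<int>\<^sup>n\<close> at distance \<open>O(1/k)\<close> from \<open>u\<close>. Then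
  \<open>k (F (x + z/k) - F x)\<close> is an integer vector, and it tends to \<open>A z\<close> as \<open>k \<rightarrow> \<infinity>\<close>, so \<open>A z\<close> is an
  integer vector. If \<open>A z = 0\<close>, the integer vectors are eventually \<open>0\<close>, and injectivity of \<open>F\<close>
  gives \<open>z = 0\<close>; hence \<open>A\<close> is invertible over the reals. By invariance of domain the same argument
  applies to the inverse of \<open>F\<close>, whose derivative at \<open>F u\<close> is the inverse of \<open>A\<close>, so this
  inverse is integral too. On a connected open set, a continuous integral Jacobian is constant, so
  \<open>F v = A v + w\<close>; the vectors \<open>k w\<close> are integral for all large \<open>k\<close>, hence so is \<open>w\<close>.
\<close>

section \<open>The integer lattice\<close>

lemma integer_points_iff: "v \<in> integer_points \<longleftrightarrow> (\<forall>i. v $ i \<in> \<int>)"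
  by (simp add: integer_points_def)

lemma integer_points_add: "v \<in> integer_points \<Longrightarrow> w \<in> integer_points \<Longrightarrow> v + w \<in> integer_points"
  by (simp add: integer_points_iff)

lemma integer_points_diff: "v \<in> integer_points \<Longrightarrow> w \<in> integer_points \<Longrightarrow> v - w \<in> integer_points"
  by (simp add: integer_points_iff)

lemma closed_integer_points: "closed (integer_points :: (real ^ 'n) set)"
proof -
  have *: "integer_points = (\<Inter>i. (\<lambda>v::real ^ 'n. v $ i) -` \<int>)"
    by (auto simp: integer_points_def)
  show ?thesis
    unfolding * by (intro closed_INT ballI closed_vimage closed_Ints continuous_intros)
qed

lemma integer_point_norm_less_1:
  assumes "v \<in> integer_points" "norm v < 1"
  shows "v = 0"
proof -
  have "v $ i = 0" for i
    using assms component_le_norm_cart[of v i] Ints_nonzero_abs_less1[of "v $ i"]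
    by (auto simp: integer_points_iff)
  then show ?thesis by (simp add: vec_eq_iff)
qed

lemma integer_matrix_vector_mult:
  assumes "\<And>i j. A $ i $ j \<in> \<int>" "v \<in> integer_points"
  shows "A *v v \<in> integer_points"
  using assms by (auto simp: integer_points_iff matrix_vector_mult_def intro!: Ints_sum Ints_mult)

section \<open>Denominators as membership in the lattices \<open>(1/k)\<int>\<^sup>n\<close>\<close>

lemma den_reduced_form:
  assumes "v \<in> rational_points"
  obtains a where "reduced_form v a (den v)"
  using reduced_form_exists[OF assms] den_eq by metis

text \<open>Coprimality of the reduced form is decisive: \<open>den v\<close> divides every
  \<open>k * a $ i\<close> as well as \<open>k * den v\<close>, hence their gcd, which is
  \<open>k\<close> up to sign.\<close>

lemma den_dvd_iff:
  assumes "v \<in> rational_points"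
  shows "den v dvd k \<longleftrightarrow> of_int k *\<^sub>R v \<in> integer_points"
proof -
  obtain a where "reduced_form v a (den v)" using den_reduced_form[OF assms] .
  then have d: "den v \<ge> 1" and v: "\<And>i. v $ i = of_int (a $ i) / of_int (den v)"
    and g: "Gcd (insert (den v) (range (\<lambda>i. a $ i))) = 1"
    by (auto simp: reduced_form_def)
  show ?thesis
  proof
    assume "den v dvd k"
    then show "of_int k *\<^sub>R v \<in> integer_points"
      using d by (auto simp: integer_points_iff v elim!: dvdE)
  next
    assume *: "of_int k *\<^sub>R v \<in> integer_points"
    have "den v dvd k * a $ i" for i
    proof -
      have "of_int k * v $ i \<in> \<int>"
        using * by (simp add: integer_points_iff)
      then obtain m where "of_int k * v $ i = of_int m"
        by (elim Ints_cases)
      then have "of_int (k * a $ i) = (of_int (m * den v) :: real)"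
        using d by (simp add: v field_simps)
      then show ?thesis by (simp only: of_int_eq_iff) simp
    qed
    then have "den v dvd Gcd ((*) k ` insert (den v) (range (\<lambda>i. a $ i)))"
      by (intro Gcd_greatest) auto
    then show "den v dvd k"
      unfolding Gcd_mult g by simp
  qed
qed

text \<open>For \<open>k > 0\<close>, the points with integral \<open>k\<close>-multiple are the
  rational ones whose denominator divides \<open>k\<close>, and \<open>F\<close> keeps
  denominators.\<close>

lemma preserves_all_denominators_lattice:
  assumes "preserves_all_denominators U F" "v \<in> U" "k > 0" "real k *\<^sub>R v \<in> integer_points"
  shows "real k *\<^sub>R F v \<in> integer_points"
proof -
  have v: "v \<in> rational_points"
    unfolding rational_points_def
  proof safe
    fix i
    have "real k * v $ i \<in> \<int>" using assms(4) by (simp add: integer_points_iff)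
    then obtain m where "real k * v $ i = of_int m" by (elim Ints_cases)
    then have "v $ i = of_int m / real k" using \<open>k > 0\<close> by (simp add: field_simps)
    then show "v $ i \<in> \<rat>" by simp
  qed
  obtain a where "reduced_form v a (den v)" using den_reduced_form[OF v] .
  then have "den v \<ge> 1" by (simp add: reduced_form_def)
  then have "F v \<in> rational_points" "den (F v) = den v"
    using assms(1,2) v unfolding preserves_all_denominators_def bij_betw_def by blast+
  then show ?thesis
    using den_dvd_iff[OF v, of "int k"] den_dvd_iff[of "F v" "int k"] assms(4) by simp
qed

text \<open>Lets the lattice argument run for the inverse of \<open>F\<close> as well.\<close>

lemma preserves_all_denominators_inverse:
  assumes "preserves_all_denominators U F" "inj_on F U"
  shows "preserves_all_denominators (F ` U) (inv_into U F)"
  unfolding preserves_all_denominators_def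
proof safe
  fix k :: int assume "k \<ge> 1"
  let ?D = "{u \<in> U \<inter> rational_points. den u = k}" and ?E = "{v \<in> F ` U \<inter> rational_points. den v = k}"
  have "bij_betw F ?D ?E"
    using assms(1) \<open>k \<ge> 1\<close> unfolding preserves_all_denominators_def by blast
  then have "bij_betw (inv_into U F) ?E ?D"
    using assms(2) by (intro bij_betw_inv_into_subset[where A' = "F ` U"]) (auto simp: bij_betw_def)
  then show "bij_betw (inv_into U F) ?E {v \<in> inv_into U F ` F ` U \<inter> rational_points. den v = k}"
    using assms(2) by simp
qed

section \<open>Scaled secants between lattice points\<close>

text \<open>Differentiability at \<open>u\<close> alone controls secants between two moving points,
  because both stay within \<open>O(1/k)\<close> of \<open>u\<close>: the remainders are
  \<open>o(1/k)\<close> and still vanish after scaling by \<open>k\<close>.\<close>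

lemma has_derivative_secant_scaled:
  fixes f :: "'a::real_normed_vector \<Rightarrow> 'b::real_normed_vector"
  assumes f: "(f has_derivative f') (at u)" and "e > 0" "C > 0"
  shows "\<exists>N. \<forall>k\<ge>N. \<forall>x y. norm (x - u) \<le> C / real k \<and> norm (y - u) \<le> C / real k
           \<longrightarrow> norm (real k *\<^sub>R (f y - f x) - f' (real k *\<^sub>R (y - x))) < e"
proof -
  interpret bounded_linear f' using f by (rule has_derivative_bounded_linear)
  \<comment> \<open>Two remainders of size at most \<open>e' * (C / real k)\<close> add up to
    \<open>e / 2\<close> after scaling by \<open>k\<close>.\<close>
  define e' where "e' = e / (4 * C)"
  have "e' > 0" using assms by (simp add: e'_def)
  then obtain d where "d > 0" and
    d: "\<And>y. norm (y - u) < d \<Longrightarrow> norm (f y - f u - f' (y - u)) \<le> e' * norm (y - u)"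
    using f unfolding has_derivative_at_alt by blast
  obtain N where N: "real N > C / d" using reals_Archimedean2 by blast
  have "N > 0" using N \<open>C > 0\<close> \<open>d > 0\<close> by (cases N) (auto simp: divide_less_0_iff)
  show ?thesis
  proof (intro exI[of _ N] allI impI; elim conjE)
    fix k x y assume "k \<ge> N" and x: "norm (x - u) \<le> C / real k" and y: "norm (y - u) \<le> C / real k"
    have k: "k > 0" using \<open>k \<ge> N\<close> \<open>N > 0\<close> by simp
    have "C / d < real k" using N \<open>k \<ge> N\<close> by simp
    then have Ck: "C / real k < d" using \<open>d > 0\<close> k by (simp add: field_simps)
    have *: "norm (f y - f u - f' (y - u)) \<le> e' * (C / real k)" if "norm (y - u) \<le> C / real k" for y
      using d[of y] that Ck mult_left_mono[OF that, of e'] \<open>e' > 0\<close> by linarith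
    have "real k *\<^sub>R (f y - f x) - f' (real k *\<^sub>R (y - x))
        = real k *\<^sub>R ((f y - f u - f' (y - u)) - (f x - f u - f' (x - u)))"
      by (simp add: scaleR diff algebra_simps)
    then have "norm (real k *\<^sub>R (f y - f x) - f' (real k *\<^sub>R (y - x)))
        \<le> real k * (norm (f y - f u - f' (y - u)) + norm (f x - f u - f' (x - u)))"
      by (simp only: norm_scaleR abs_of_nat) (intro mult_left_mono norm_triangle_ineq4 of_nat_0_le_iff)
    also have "\<dots> \<le> real k * (e' * (C / real k) + e' * (C / real k))"
      using *[OF x] *[OF y] by (intro mult_left_mono add_mono) auto
    also have "\<dots> = e / 2" using k \<open>C > 0\<close> by (simp add: e'_def field_simps)
    finally show "norm (real k *\<^sub>R (f y - f x) - f' (real k *\<^sub>R (y - x))) < e"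
      using \<open>e > 0\<close> by linarith
  qed
qed

text \<open>Rounding down moves each coordinate by at most \<open>1/k\<close>; bounding the
  Euclidean norm by the l1 norm gives the dimension factor.\<close>

lemma nearby_lattice_point:
  fixes u :: "real ^ 'n"
  assumes "k > 0"
  obtains x where "real k *\<^sub>R x \<in> integer_points" "norm (x - u) \<le> real CARD('n) / real k"
proof
  let ?x = "\<chi> i. of_int \<lfloor>real k * u $ i\<rfloor> / real k"
  show "real k *\<^sub>R ?x \<in> integer_points" using assms by (simp add: integer_points_iff)
  have "\<bar>(?x - u) $ i\<bar> \<le> 1 / real k" for i
  proof -
    have "real k * \<bar>(?x - u) $ i\<bar> = \<bar>real k * (?x - u) $ i\<bar>" by (simp add: abs_mult)
    also have "real k * (?x - u) $ i = of_int \<lfloor>real k * u $ i\<rfloor> - real k * u $ i"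
      using assms by (simp add: field_simps)
    also have "\<bar>\<dots>\<bar> \<le> 1" by linarith
    finally show ?thesis using assms by (simp add: field_simps)
  qed
  then have "(\<Sum>i\<in>UNIV. \<bar>(?x - u) $ i\<bar>) \<le> (\<Sum>i\<in>(UNIV :: 'n set). 1 / real k)"
    by (intro sum_mono) auto
  then show "norm (?x - u) \<le> real CARD('n) / real k"
    using norm_le_l1_cart[of "?x - u"] by simp
qed

lemma lattice_secant:
  fixes F :: "real ^ 'n \<Rightarrow> real ^ 'n"
  assumes "open U" "u \<in> U" "(F has_derivative F') (at u)" "z \<in> integer_points" "e > 0"
  obtains k x where "k > 0" "x \<in> U" "x + z /\<^sub>R real k \<in> U" "real k *\<^sub>R x \<in> integer_points"
    "norm (real k *\<^sub>R (F (x + z /\<^sub>R real k) - F x) - F' z) < e"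
proof -
  \<comment> \<open>Serves both endpoints: \<open>x\<close> is within \<open>CARD('n)/k\<close> of
    \<open>u\<close>, and the shift by \<open>z/k\<close> adds at most
    \<open>norm z / k\<close>.\<close>
  define C where "C = real CARD('n) + norm z"
  have "C > 0" by (simp add: C_def add_pos_nonneg)
  obtain r where "r > 0" and r: "ball u r \<subseteq> U" using assms(1,2) by (meson openE)
  obtain N where N: "\<forall>k\<ge>N. \<forall>x y. norm (x - u) \<le> C / real k \<and> norm (y - u) \<le> C / real k
      \<longrightarrow> norm (real k *\<^sub>R (F y - F x) - F' (real k *\<^sub>R (y - x))) < e"
    using has_derivative_secant_scaled[OF assms(3,5) \<open>C > 0\<close>] by blast
  obtain M where M: "real M > C / r" using reals_Archimedean2 by blast
  \<comment> \<open>\<open>N\<close> ensures accuracy \<open>e\<close>, \<open>M\<close> keeps both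
    endpoints in the ball inside \<open>U\<close>, and \<open>Suc\<close> gives
    \<open>k > 0\<close>.\<close>
  define k where "k = Suc (max N M)"
  have "k > 0" "k \<ge> N" by (auto simp: k_def)
  have "C / r < real k" using M by (simp add: k_def)
  then have Ck: "C / real k < r" using \<open>r > 0\<close> \<open>k > 0\<close> by (simp add: field_simps)
  obtain x where x: "real k *\<^sub>R x \<in> integer_points" "norm (x - u) \<le> real CARD('n) / real k"
    using nearby_lattice_point[OF \<open>k > 0\<close>] .
  let ?y = "x + z /\<^sub>R real k"
  have nx: "norm (x - u) \<le> C / real k"
    using x(2) \<open>k > 0\<close> by (simp add: C_def add_divide_distrib add_increasing2)
  have "norm (?y - u) \<le> norm (x - u) + norm (z /\<^sub>R real k)"
    using norm_triangle_ineq[of "x - u" "z /\<^sub>R real k"] by (simp add: algebra_simps)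
  then have ny: "norm (?y - u) \<le> C / real k"
    using x(2) \<open>k > 0\<close> by (simp add: C_def divide_inverse_commute distrib_left)
  have "x \<in> U" "?y \<in> U"
    using r nx ny Ck by (auto simp: dist_norm norm_minus_commute subset_iff)
  moreover have "real k *\<^sub>R (?y - x) = z" using \<open>k > 0\<close> by simp
  ultimately show ?thesis
    using that[OF \<open>k > 0\<close>] x(1) N \<open>k \<ge> N\<close> nx ny by metis
qed

text \<open>Integral secants approximate \<open>F' z\<close> arbitrarily well. The lattice is
  closed, so \<open>F' z\<close> is integral; it is discrete, so if \<open>F' z = 0\<close> some
  secant vanishes exactly and injectivity applies.\<close>

lemma lattice_derivative:
  fixes F :: "real ^ 'n \<Rightarrow> real ^ 'n"
  assumes "open U" "u \<in> U" "(F has_derivative F') (at u)" "inj_on F U"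
    and lattice: "\<And>k v. v \<in> U \<Longrightarrow> k > 0 \<Longrightarrow> real k *\<^sub>R v \<in> integer_points
                    \<Longrightarrow> real k *\<^sub>R F v \<in> integer_points"
    and z: "z \<in> integer_points"
  shows "F' z \<in> integer_points" and "F' z = 0 \<Longrightarrow> z = 0"
proof -
  have *: "\<exists>k>0. \<exists>x\<in>U. x + z /\<^sub>R real k \<in> U
      \<and> real k *\<^sub>R (F (x + z /\<^sub>R real k) - F x) \<in> integer_points
      \<and> norm (real k *\<^sub>R (F (x + z /\<^sub>R real k) - F x) - F' z) < e" if e: "e > 0" for e
  proof -
    obtain k x where kx: "k > 0" "x \<in> U" "x + z /\<^sub>R real k \<in> U" "real k *\<^sub>R x \<in> integer_points"
      "norm (real k *\<^sub>R (F (x + z /\<^sub>R real k) - F x) - F' z) < e"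
      using lattice_secant[OF assms(1-3) z e] .
    have "real k *\<^sub>R (x + z /\<^sub>R real k) = real k *\<^sub>R x + z"
      using kx(1) by (simp add: scaleR_add_right)
    then have "real k *\<^sub>R (x + z /\<^sub>R real k) \<in> integer_points"
      using kx(4) z by (simp add: integer_points_add)
    then have "real k *\<^sub>R F (x + z /\<^sub>R real k) - real k *\<^sub>R F x \<in> integer_points"
      using kx(1-4) by (intro integer_points_diff lattice)
    then show ?thesis using kx by (auto simp: scaleR_diff_right)
  qed
  have "F' z \<in> closure integer_points"
    unfolding closure_approachable dist_norm using * by blast
  then show "F' z \<in> integer_points" by (simp add: closed_integer_points)
  assume "F' z = 0"
  then obtain k x where kx: "k > 0" "x \<in> U" "x + z /\<^sub>R real k \<in> U"
      "real k *\<^sub>R (F (x + z /\<^sub>R real k) - F x) \<in> integer_points"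
      "norm (real k *\<^sub>R (F (x + z /\<^sub>R real k) - F x)) < 1"
    using *[of 1] by auto
  then have "real k *\<^sub>R (F (x + z /\<^sub>R real k) - F x) = 0"
    by (intro integer_point_norm_less_1)
  then have "F (x + z /\<^sub>R real k) = F x" using kx(1) by simp
  then have "x + z /\<^sub>R real k = x" using kx(2,3) \<open>inj_on F U\<close> by (auto dest: inj_onD)
  then show "z = 0" using kx(1) by simp
qed

section \<open>Integer matrices and their inverses\<close>

lemma integer_matrixI:
  fixes A :: "real ^ 'n ^ 'n"
  assumes "\<And>z. z \<in> integer_points \<Longrightarrow> A *v z \<in> integer_points"
  shows "A $ i $ j \<in> \<int>"
proof -
  have "axis j 1 \<in> (integer_points :: (real ^ 'n) set)" by (simp add: integer_points_iff axis_def)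
  from assms[OF this] have "(A *v axis j 1) $ i \<in> \<int>" by (simp add: integer_points_iff)
  then show ?thesis by (simp add: matrix_vector_mult_basis column_def)
qed

text \<open>Integrality of \<open>A\<close> matters: a singular real matrix with irrational entries
  can have a kernel that meets the lattice only in \<open>0\<close>.\<close>

lemma integer_matrix_invertibleI:
  fixes A :: "real ^ 'n ^ 'n"
  assumes A: "\<And>i j. A $ i $ j \<in> \<int>"
    and ker: "\<And>z. z \<in> integer_points \<Longrightarrow> A *v z = 0 \<Longrightarrow> z = 0"
  shows "invertible A"
proof -
  \<comment> \<open>Over the rationals, clearing denominators moves any kernel vector into the lattice.\<close>
  have "\<exists>m. A $ i $ j = of_int m" for i j using A by (metis Ints_cases)
  then obtain m where m: "\<And>i j. A $ i $ j = of_int (m i j)" by metis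
  define Q :: "rat ^ 'n ^ 'n" where "Q = (\<chi> i j. of_int (m i j))"
  have "q = 0" if "Q *v q = 0" for q
  proof -
    define v :: "real ^ 'n" where "v = (\<chi> i. of_rat (q $ i))"
    have "(A *v v) $ i = of_rat ((Q *v q) $ i)" for i
      by (simp add: matrix_vector_mult_def v_def Q_def m of_rat_sum of_rat_mult)
    then have "A *v v = 0" using that by (simp add: vec_eq_iff)
    have v: "v \<in> rational_points" by (simp add: rational_points_def v_def)
    obtain a where "reduced_form v a (den v)" using den_reduced_form[OF v] .
    then have d: "den v \<ge> 1" by (simp add: reduced_form_def)
    have "of_int (den v) *\<^sub>R v \<in> integer_points" using den_dvd_iff[OF v, of "den v"] by simp
    moreover have "A *v (of_int (den v) *\<^sub>R v) = 0"
      using \<open>A *v v = 0\<close> by (simp add: matrix_vector_mult_scaleR)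
    ultimately have "v = 0" using ker d by fastforce
    then show "q = 0" by (simp add: v_def vec_eq_iff)
  qed
  then obtain B where B: "B ** Q = mat 1" by (metis matrix_left_invertible_ker)
  \<comment> \<open>Casting is a ring homomorphism, so the rational left inverse becomes a real
    one.\<close>
  have "(map_matrix of_rat B ** A) $ i $ j = of_rat ((B ** Q) $ i $ j)" for i j
    by (simp add: matrix_matrix_mult_def Q_def m of_rat_sum of_rat_mult)
  then have "map_matrix of_rat B ** A = mat 1"
    by (simp add: B vec_eq_iff mat_def)
  then show ?thesis using invertible_left_inverse by blast
qed

text \<open>\<open>GL_int\<close> demands an inverse among integer matrices; the real identities are
  pulled back along the injective homomorphism \<open>of_int\<close>.\<close>

lemma GL_intI:
  fixes A B :: "real ^ 'n ^ 'n"
  assumes "\<And>i j. A $ i $ j \<in> \<int>" "\<And>i j. B $ i $ j \<in> \<int>" "A ** B = mat 1"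
  shows "A \<in> GL_int"
proof -
  have "\<exists>M. C = map_matrix of_int M" if "\<And>i j. C $ i $ j \<in> \<int>" for C :: "real ^ 'n ^ 'n"
  proof -
    have "C = map_matrix of_int (\<chi> i j. \<lfloor>C $ i $ j\<rfloor>)" using that by (simp add: vec_eq_iff)
    then show ?thesis by blast
  qed
  then obtain M N where M: "A = map_matrix of_int M" and N: "B = map_matrix of_int N"
    using assms(1,2) by meson
  have hom: "P ** R = mat 1"
    if "map_matrix of_int P ** map_matrix of_int R = (mat 1 :: real ^ 'n ^ 'n)" for P R
  proof -
    have "(of_int ((P ** R) $ i $ j) :: real) = of_int (mat 1 $ i $ j)" for i j
      using arg_cong[OF that, of "\<lambda>C. C $ i $ j"]
      by (simp add: matrix_matrix_mult_def mat_def)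
    then show ?thesis by (simp add: vec_eq_iff)
  qed
  have "B ** A = mat 1" using assms(3) by (simp add: matrix_left_right_inverse)
  then have "invertible M"
    using hom[of M N] hom[of N M] assms(3) unfolding M N invertible_def by blast
  then show ?thesis unfolding GL_int_def M by blast
qed

lemma GL_int_entry: "A \<in> GL_int \<Longrightarrow> A $ i $ j \<in> \<int>"
  by (auto simp: GL_int_def)

section \<open>Integrality of the Jacobian and of its inverse\<close>

lemma jacobian_in_GL_int:
  fixes U :: "(real ^ 'n) set" and F :: "real ^ 'n \<Rightarrow> real ^ 'n"
  assumes U: "open U" and cont: "continuous_on U F" and inj: "inj_on F U"
    and den: "preserves_all_denominators U F"
    and u: "u \<in> U" and diff: "F differentiable (at u)"
  shows "jacobian F (at u) \<in> GL_int"
proof -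
  define A where "A = jacobian F (at u)"
  have F': "(F has_derivative (*v) A) (at u)"
    using diff unfolding A_def jacobian_works .
  note AL = lattice_derivative[OF U u F' inj preserves_all_denominators_lattice[OF den]]
  have A: "A $ i $ j \<in> \<int>" for i j by (rule integer_matrixI) (rule AL(1))
  have "invertible A" using A AL(2) by (rule integer_matrix_invertibleI)
  then obtain B where AB: "A ** B = mat 1" and BA: "B ** A = mat 1"
    unfolding invertible_def by blast
  let ?G = "inv_into U F"
  have "(*v) A \<circ> (*v) B = id"
    by (auto simp: fun_eq_iff matrix_vector_mul_assoc AB)
  \<comment> \<open>The strong inverse rule asks for differentiability of \<open>F\<close> only at
    \<open>u\<close>, together with continuity on the open set \<open>U\<close>.\<close>
  then have G': "(?G has_derivative (*v) B) (at (F u))"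
    using has_derivative_inverse_strong[OF U u cont _ F', of ?G "(*v) B"] inj by simp
  have "open (F ` U)" using cont U inj by (rule invariance_of_domain)
  moreover have "inj_on ?G (F ` U)" by (rule inj_on_inv_into) simp
  ultimately have "B $ i $ j \<in> \<int>" for i j
    using u by (intro integer_matrixI lattice_derivative(1)[OF _ _ G' _
          preserves_all_denominators_lattice[OF preserves_all_denominators_inverse[OF den inj]]]) auto
  with A show ?thesis unfolding A_def[symmetric] using AB by (rule GL_intI)
qed

section \<open>From a constant Jacobian to the affine formula\<close>

text \<open>Distinct integers differ by at least \<open>1\<close>, so each entry has discrete
  range.\<close>

lemma integer_matrix_constant_on:
  fixes f :: "'a::topological_space \<Rightarrow> real ^ 'n ^ 'm"
  assumes "connected S" "continuous_on S f" "\<And>x i j. x \<in> S \<Longrightarrow> f x $ i $ j \<in> \<int>"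
  shows "f constant_on S"
proof -
  have "(\<lambda>x. f x $ i $ j) constant_on S" for i j
  proof (rule continuous_discrete_range_constant[OF assms(1)])
    show "continuous_on S (\<lambda>x. f x $ i $ j)" using assms(2) by (intro continuous_intros)
    fix x assume "x \<in> S"
    have "1 \<le> \<bar>f y $ i $ j - f x $ i $ j\<bar>" if "y \<in> S" "f y $ i $ j \<noteq> f x $ i $ j" for y
      using that assms(3) \<open>x \<in> S\<close> by (intro Ints_nonzero_abs_ge1 Ints_diff) auto
    then show "\<exists>e>0. \<forall>y. y \<in> S \<and> f y $ i $ j \<noteq> f x $ i $ j \<longrightarrow> e \<le> norm (f y $ i $ j - f x $ i $ j)"
      by (intro exI[of _ 1]) auto
  qed
  then have "f x = f y" if "x \<in> S" "y \<in> S" for x y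
    using that unfolding constant_on_def vec_eq_iff by metis
  then show ?thesis unfolding constant_on_def by metis
qed

text \<open>\<open>V\<close> may contain no integer point, so \<open>w\<close> is reached through
  finer lattices: a point \<open>x\<close> of \<open>V\<close> with \<open>k x\<close> integral
  gives \<open>k w = k F x - A (k x)\<close>.\<close>

lemma affine_lattice_translation:
  fixes F :: "real ^ 'n \<Rightarrow> real ^ 'n"
  assumes "open V" "v \<in> V"
    and A: "\<And>i j. A $ i $ j \<in> \<int>" and F: "\<And>v. v \<in> V \<Longrightarrow> F v = A *v v + w"
    and lattice: "\<And>k v. v \<in> V \<Longrightarrow> k > 0 \<Longrightarrow> real k *\<^sub>R v \<in> integer_points
                    \<Longrightarrow> real k *\<^sub>R F v \<in> integer_points"
  shows "w \<in> integer_points"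
proof -
  obtain r where "r > 0" and r: "ball v r \<subseteq> V" using assms(1,2) by (meson openE)
  obtain N where N: "real N > real CARD('n) / r" using reals_Archimedean2 by blast
  have kw: "real k *\<^sub>R w \<in> integer_points" if "k \<ge> N" "k > 0" for k
  proof -
    obtain x where x: "real k *\<^sub>R x \<in> integer_points" "norm (x - v) \<le> real CARD('n) / real k"
      using nearby_lattice_point[OF \<open>k > 0\<close>] .
    have "real CARD('n) / r < real k" using N that by simp
    then have "real CARD('n) / real k < r" using \<open>r > 0\<close> \<open>k > 0\<close> by (simp add: field_simps)
    then have "x \<in> V" using r x(2) by (auto simp: dist_norm norm_minus_commute subset_iff)
    then have "real k *\<^sub>R F x - A *v (real k *\<^sub>R x) \<in> integer_points"
      using lattice[OF _ \<open>k > 0\<close> x(1)] integer_matrix_vector_mult[OF A x(1)]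
      by (intro integer_points_diff)
    then show ?thesis
      by (simp add: F[OF \<open>x \<in> V\<close>] scaleR_add_right matrix_vector_mult_scaleR)
  qed
  \<comment> \<open>Two consecutive multiples of \<open>w\<close> differ by \<open>w\<close>
    itself.\<close>
  have "real (Suc (Suc N)) *\<^sub>R w - real (Suc N) *\<^sub>R w \<in> integer_points"
    by (intro integer_points_diff kw) auto
  then show ?thesis by (simp flip: scaleR_diff_left)
qed

theorem theorem5p2:
  fixes U :: "(real ^ 'n) set" and F :: "real ^ 'n \<Rightarrow> real ^ 'n"
  assumes "open U"
    and "continuous_on U F"
    and "inj_on F U"
    and "preserves_all_denominators U F"
  shows "(\<forall>u\<in>U. F differentiable (at u) \<longrightarrow> jacobian F (at u) \<in> GL_int) \<and>
         (\<forall>V\<subseteq>U. open V \<and> connected V \<and> continuously_differentiable_on F V \<longrightarrow>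
            (\<exists>A\<in>GL_int. \<exists>w\<in>integer_points. \<forall>v\<in>V. F v = A *v v + w))"
proof (intro conjI ballI allI impI; (elim conjE)?)
  note GL = jacobian_in_GL_int[OF assms]
  show "jacobian F (at u) \<in> GL_int" if "u \<in> U" "F differentiable (at u)" for u
    using GL that .
  fix V assume V: "V \<subseteq> U" "open V" "connected V" "continuously_differentiable_on F V"
  show "\<exists>A\<in>GL_int. \<exists>w\<in>integer_points. \<forall>v\<in>V. F v = A *v v + w"
  proof (cases "V = {}")
    case True
    \<comment> \<open>There is no base point here; the identity and \<open>0\<close> are arbitrary
      witnesses.\<close>
    have "mat 1 \<in> (GL_int :: (real ^ 'n ^ 'n) set)"
      by (rule GL_intI[OF _ _ matrix_mul_lid]) (simp_all add: mat_def)
    moreover have "0 \<in> (integer_points :: (real ^ 'n) set)" by (simp add: integer_points_iff)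
    ultimately show ?thesis using True by blast
  next
    case False
    then obtain p where p: "p \<in> V" by blast
    define A where "A = jacobian F (at p)"
    have diff: "F differentiable (at v)" if "v \<in> V" for v
      using V(4) that by (simp add: continuously_differentiable_on_def)
    have A: "A \<in> GL_int" unfolding A_def using GL p V(1) diff by blast
    have "(\<lambda>v. jacobian F (at v)) constant_on V"
      using V GL diff
      by (intro integer_matrix_constant_on) (auto simp: continuously_differentiable_on_def intro!: GL_int_entry)
    then have "jacobian F (at v) = A" if "v \<in> V" for v
      using that p unfolding constant_on_def A_def by metis
    then have F': "(F has_derivative (*v) A) (at v)" if "v \<in> V" for v
      using diff[OF that] that unfolding jacobian_works by simp
    have "((\<lambda>v. F v - A *v v) has_derivative (\<lambda>h. 0)) (at v)" if "v \<in> V" for v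
      using has_derivative_diff[OF F'[OF that], of "(*v) A" "(*v) A"]
      by (simp add: bounded_linear_imp_has_derivative)
    \<comment> \<open>\<open>F v - A *v v\<close> is constant on the connected set \<open>V\<close>,
      so its value at \<open>p\<close> is the translation vector.\<close>
    from has_derivative_zero_unique_connected[OF V(2,3) this _ p]
    have F: "F v = A *v v + (F p - A *v p)" if "v \<in> V" for v
      using that by (force simp: algebra_simps)
    have "F p - A *v p \<in> integer_points"
      using V(2) p GL_int_entry[OF A] F
    proof (rule affine_lattice_translation)
      fix k v assume "v \<in> V" "k > 0" "real k *\<^sub>R v \<in> integer_points"
      then show "real k *\<^sub>R F v \<in> integer_points"
        using V(1) by (blast intro: preserves_all_denominators_lattice[OF assms(4)])
    qed
    then show ?thesis using A F by blast
  qed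
qed

end
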